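(* Let $A=\{a_1,\dots,a_r\}$, let $F$ be the free group on $A$, and let $G=\langle A\mid R\rangle$ be a finite presentation of an abelian quotient of $F$. Let $T$ be any geodesic combing in the Cayley graph $\Gamma(G)$ of $G$ with respect to $A$. Then there is a constant $K$ such that for every integer $n\ge 2$ $$D_{\mathrm{osmean}}(n)\le K\, n(\ln n)^2,$$ where $D_{\mathrm{osmean}}$ is the open spherical mean Dehn function of the presentation with respect to $T$.
   Context: Let $A^*$ be the free monoid on $A\cup A^{-1}$ (possibly non-reduced words). Words $w\in A^*$ are identified with paths in the Cayley graph $\Gamma(G)$ starting at the identity vertex $e$ (backtrackings allowed); $|w|_A$ is the number of letters. If $w$ represents $1$ in $G$, $\operatorname{area}(w)$ is the minimal $m\ge 0$ such that in $F$ one can write $w=\prod_{i=1}^m f_i^{-1}r_i^{\epsilon_i}f_i$ with $f_i\in F$, $r_i\in R$, $\epsilon_i=\pm1$. A combing in $\Gamma(G)$ is a set $T$ consisting of exactly one path $T[v]$ from $e$ to $v$ for every vertex $v$, with $T[e]$ the trivial path; it is geodesic if every $T[v]$ is a geodesic (a path of minimal possible length from $e$ to $v$). For an arbitrary word $w\in A^*$, viewed as a path from $e$ to the vertex $v$ it represents, one defines $\operatorname{area}(w)=\operatorname{area}\bigl(w\,T[v]^{-1}\bigr)$ (with $T[v]$ identified with the word it reads), the area of a word representing $1$; this agrees with the previous definition when $v=e$. The open spherical mean Dehn function is $$D_{\mathrm{osmean}}(n)=\frac{1}{(2r)^n}\sum_{w\in A^*,\ |w|_A=n}\operatorname{area}(w).$$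 Here $\ln$ is the natural logarithm. *)

theory Defs
  imports Complex_Main "HOL-Algebra.Coset" "HOL-Algebra.Generated_Groups"
begin

(* (a, True) stands for the generator a, (a, False) for its formal inverse. *)
type_synonym 'a letter = "'a \<times> bool"
type_synonym 'a word = "'a letter list"

definition letters :: "'a set \<Rightarrow> 'a letter set" where
  "letters A = A \<times> UNIV"

definition words :: "'a set \<Rightarrow> 'a word set" where
  "words A = lists (letters A)"

definition inv_letter :: "'a letter \<Rightarrow> 'a letter" where
  "inv_letter x = (fst x, \<not> snd x)"

definition inv_word :: "'a word \<Rightarrow> 'a word" where
  "inv_word w = rev (map inv_letter w)"

definition reduced :: "'a word \<Rightarrow> bool" where
  "reduced w \<longleftrightarrow> successively (\<lambda>x y. y \<noteq> inv_letter x) w"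

fun cancel_cons :: "'a letter \<Rightarrow> 'a word \<Rightarrow> 'a word" where
  "cancel_cons x [] = [x]"
| "cancel_cons x (y # w) = (if y = inv_letter x then w else x # y # w)"

definition reduce :: "'a word \<Rightarrow> 'a word" where
  "reduce w = foldr cancel_cons w []"

definition free_group :: "'a set \<Rightarrow> 'a word monoid" where
  "free_group A = \<lparr>carrier = {w \<in> words A. reduced w},
                   mult = (\<lambda>u v. reduce (u @ v)),
                   one = []\<rparr>"

definition normal_closure :: "('g, 'm) monoid_scheme \<Rightarrow> 'g set \<Rightarrow> 'g set" where
  "normal_closure G S = \<Inter> {N. N \<lhd> G \<and> S \<subseteq> N}"

definition presented_group :: "'a set \<Rightarrow> 'a word set \<Rightarrow> 'a word set monoid" where
  "presented_group A R = free_group A Mod normal_closure (free_group A) R"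

definition presented_gen :: "'a set \<Rightarrow> 'a word set \<Rightarrow> 'a letter \<Rightarrow> 'a word set" where
  "presented_gen A R x = normal_closure (free_group A) R #>\<^bsub>free_group A\<^esub> [x]"

(* The Cayley graph has, for every vertex v and every letter x, an edge labelled x from v to
   v times the image of x.  A path is thus determined by its initial vertex and its label;
   cayley_end gives its terminal vertex. *)
definition cayley_end :: "'a set \<Rightarrow> 'a word set \<Rightarrow> 'a word set \<Rightarrow> 'a word \<Rightarrow> 'a word set" where
  "cayley_end A R v w = foldl (\<lambda>u x. u \<otimes>\<^bsub>presented_group A R\<^esub> presented_gen A R x) v w"

definition represented :: "'a set \<Rightarrow> 'a word set \<Rightarrow> 'a word \<Rightarrow> 'a word set" where
  "represented A R w = cayley_end A R \<one>\<^bsub>presented_group A R\<^esub> w"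

definition conj_product ::
    "'a set \<Rightarrow> ('a word \<times> 'a word \<times> int) list \<Rightarrow> 'a word" where
  "conj_product A cs =
     foldr (\<lambda>(f, r, e) p.
         (inv\<^bsub>free_group A\<^esub> f \<otimes>\<^bsub>free_group A\<^esub> (r [^]\<^bsub>free_group A\<^esub> e) \<otimes>\<^bsub>free_group A\<^esub> f)
         \<otimes>\<^bsub>free_group A\<^esub> p)
       cs \<one>\<^bsub>free_group A\<^esub>"

(* Meaningful for words representing the identity; reduce w is the element of the free group
   given by the word w. *)
definition area :: "'a set \<Rightarrow> 'a word set \<Rightarrow> 'a word \<Rightarrow> nat" where
  "area A R w =
     (LEAST m. \<exists>cs. length cs = m
        \<and> set cs \<subseteq> carrier (free_group A) \<times> R \<times> {1, -1}
        \<and> reduce w = conj_product A cs)"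

definition combing :: "'a set \<Rightarrow> 'a word set \<Rightarrow> ('a word set \<Rightarrow> 'a word) \<Rightarrow> bool" where
  "combing A R T \<longleftrightarrow>
     (\<forall>v \<in> carrier (presented_group A R). T v \<in> words A \<and> represented A R (T v) = v)
     \<and> T \<one>\<^bsub>presented_group A R\<^esub> = []"

definition geodesic :: "'a set \<Rightarrow> 'a word set \<Rightarrow> 'a word \<Rightarrow> bool" where
  "geodesic A R w \<longleftrightarrow>
     (\<forall>u \<in> words A. represented A R u = represented A R w \<longrightarrow> length w \<le> length u)"

definition geodesic_combing :: "'a set \<Rightarrow> 'a word set \<Rightarrow> ('a word set \<Rightarrow> 'a word) \<Rightarrow> bool" where
  "geodesic_combing A R T \<longleftrightarrow>
     combing A R T \<and> (\<forall>v \<in> carrier (presented_group A R). geodesic A R (T v))"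

definition open_area ::
    "'a set \<Rightarrow> 'a word set \<Rightarrow> ('a word set \<Rightarrow> 'a word) \<Rightarrow> 'a word \<Rightarrow> nat" where
  "open_area A R T w = area A R (w @ inv_word (T (represented A R w)))"

definition D_osmean ::
    "'a set \<Rightarrow> 'a word set \<Rightarrow> ('a word set \<Rightarrow> 'a word) \<Rightarrow> nat \<Rightarrow> real" where
  "D_osmean A R T n =
     1 / (2 * real (card A)) ^ n *
       (\<Sum>w \<in> {w \<in> words A. length w = n}. real (open_area A R T w))"

lemma inv_letter_simps [simp]:
  "inv_letter (inv_letter x) = x" "inv_letter x \<noteq> x"
  "inv_letter x \<in> letters A \<longleftrightarrow> x \<in> letters A"
  by (cases x; auto simp: inv_letter_def letters_def)+

lemma reduced_Nil [simp]: "reduced []"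
  and reduced_Cons: "reduced (x # w) \<longleftrightarrow> reduced w \<and> (w = [] \<or> hd w \<noteq> inv_letter x)"
  by (auto simp: reduced_def successively_Cons)

lemma reduced_cancel_cons: "reduced w \<Longrightarrow> reduced (cancel_cons x w)"
  by (cases w) (auto simp: reduced_Cons)

lemma reduced_foldr_cancel_cons: "reduced v \<Longrightarrow> reduced (foldr cancel_cons u v)"
  by (induction u) (auto intro: reduced_cancel_cons)

lemma reduced_reduce [simp]: "reduced (reduce w)"
  by (simp add: reduce_def reduced_foldr_cancel_cons)

lemma reduce_simps [simp]:
  "reduce [] = []" "reduce (x # w) = cancel_cons x (reduce w)"
  by (auto simp: reduce_def)

lemma reduce_reduced: "reduced w \<Longrightarrow> reduce w = w"
proof (induction w)
  case (Cons x w)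
  then show ?case by (cases w) (auto simp: reduced_Cons)
qed simp

lemma cancel_cons_inverse:
  assumes "reduced w"
  shows "cancel_cons (inv_letter x) (cancel_cons x w) = w"
proof (cases w)
  case (Cons y v)
  with assms show ?thesis
    by (cases v) (auto simp: reduced_Cons)
qed simp

lemma foldr_cancel_cons_reduce:
  assumes "reduced v"
  shows "foldr cancel_cons (reduce u) v = foldr cancel_cons u v"
proof (induction u)
  case (Cons x u)
  have "foldr cancel_cons (cancel_cons x s) v = cancel_cons x (foldr cancel_cons s v)" for s
  proof (cases s)
    case (Cons y t)
    have "cancel_cons x (cancel_cons (inv_letter x) (foldr cancel_cons t v))
            = foldr cancel_cons t v"
      using cancel_cons_inverse[OF reduced_foldr_cancel_cons[OF assms], of "inv_letter x" t]
      by simp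
    with Cons show ?thesis by auto
  qed simp
  with Cons show ?case by simp
qed simp

lemma reduce_append: "reduce (u @ v) = foldr cancel_cons u (reduce v)"
  by (simp add: reduce_def)

lemma reduce_append_reduce [simp]:
  "reduce (reduce u @ v) = reduce (u @ v)" "reduce (u @ reduce v) = reduce (u @ v)"
  by (simp_all add: reduce_append foldr_cancel_cons_reduce reduce_reduced)

lemma reduce_inv_word_append: "reduce (inv_word w @ w) = []"
proof (induction w)
  case (Cons x w)
  have "reduce (inv_word (x # w) @ x # w)
          = foldr cancel_cons (inv_word w) (cancel_cons (inv_letter x) (cancel_cons x (reduce w)))"
    by (simp add: inv_word_def reduce_append)
  also have "\<dots> = reduce (inv_word w @ w)"
    by (simp add: cancel_cons_inverse reduce_append)
  finally show ?case using Cons by simp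
qed (simp add: inv_word_def)

lemma words_simps [simp]:
  "[] \<in> words A" "x # w \<in> words A \<longleftrightarrow> x \<in> letters A \<and> w \<in> words A"
  "u @ v \<in> words A \<longleftrightarrow> u \<in> words A \<and> v \<in> words A"
  "inv_word w \<in> words A \<longleftrightarrow> w \<in> words A"
  by (auto simp: words_def inv_word_def in_lists_conv_set)

lemma cancel_cons_in_words: "x \<in> letters A \<Longrightarrow> w \<in> words A \<Longrightarrow> cancel_cons x w \<in> words A"
  by (cases w) auto

lemma reduce_in_words: "w \<in> words A \<Longrightarrow> reduce w \<in> words A"
  by (induction w) (auto intro: cancel_cons_in_words)

lemma group_free_group: "group (free_group A)"
proof (rule groupI)
  fix w assume w: "w \<in> carrier (free_group A)"
  show "\<exists>u \<in> carrier (free_group A). u \<otimes>\<^bsub>free_group A\<^esub> w = \<one>\<^bsub>free_group A\<^esub>"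
  proof
    show "reduce (inv_word w) \<in> carrier (free_group A)"
      using w by (simp add: free_group_def reduce_in_words)
    show "reduce (inv_word w) \<otimes>\<^bsub>free_group A\<^esub> w = \<one>\<^bsub>free_group A\<^esub>"
      by (simp add: free_group_def reduce_inv_word_append)
  qed
qed (auto simp: free_group_def reduce_in_words reduce_reduced)

lemma normal_normal_closure:
  assumes "group G" "S \<subseteq> carrier G"
  shows "normal_closure G S \<lhd> G"
proof -
  interpret group G by fact
  have ne: "carrier G \<in> {N. N \<lhd> G \<and> S \<subseteq> N}"
    using assms(2) by (auto intro!: normal_invI subgroup_self)
  show ?thesis
    unfolding normal_closure_def
  proof (rule normal_invI)
    show "subgroup (\<Inter> {N. N \<lhd> G \<and> S \<subseteq> N}) G"
      using ne by (intro subgroups_Inter) (auto simp: normal_imp_subgroup)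
    show "\<And>g h. g \<in> carrier G \<Longrightarrow> h \<in> \<Inter> {N. N \<lhd> G \<and> S \<subseteq> N} \<Longrightarrow>
            g \<otimes>\<^bsub>G\<^esub> h \<otimes>\<^bsub>G\<^esub> inv\<^bsub>G\<^esub> g \<in> \<Inter> {N. N \<lhd> G \<and> S \<subseteq> N}"
      by (auto intro: normal.inv_op_closed2)
  qed
qed

lemma group_presented_group:
  "R \<subseteq> carrier (free_group A) \<Longrightarrow> group (presented_group A R)"
  unfolding presented_group_def
  by (intro normal.factorgroup_is_group normal_normal_closure group_free_group)

end

theory Submission
  imports Defs "HOL-Library.Multiset" "HOL-Analysis.Convex"
begin

text \<open>
  Cut a random word \<open>w\<close> of length \<open>m + n\<close> as \<open>w = u v\<close> and replace \<open>u\<close> and \<open>v\<close> by their combing paths.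
  Then \<open>area w\<close> is at most \<open>area u + area v\<close> plus the area of the triangle \<open>T[u] T[v] T[uv]\<^sup>-\<^sup>1\<close>. In an abelian
  group a null-homotopic word of length \<open>l\<close> has area \<open>O(l\<^sup>2)\<close>: sorting costs \<open>O(l\<^sup>2)\<close> commutators, and by
  Dickson's lemma every null-homotopic word is, up to the order of its letters, a concatenation of null-homotopic
  words from a finite list. Since the combing is geodesic, \<open>T[u]\<close> is no longer than the sum over
  the generators \<open>a\<close> of the absolute exponent sums of \<open>a\<close> in \<open>u\<close>, and each exponent sum is a lazy simple random walk with
  second moment at most \<open>m\<close>. Hence \<open>D (m + n) \<le> D m + D n + c (m + n)\<close>, and halving
  repeatedly gives even \<open>D n = O(n ln n)\<close>.
\<close>

section \<open>Fillings and area in the free group\<close>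

lemma reduce_in_carrier [simp]: "w \<in> words A \<Longrightarrow> reduce w \<in> carrier (free_group A)"
  by (simp add: free_group_def reduce_in_words)

lemma one_free_group: "\<one>\<^bsub>free_group A\<^esub> = []"
  by (simp add: free_group_def)

locale presentation =
  fixes A :: "'a set" and R :: "'a word set"
  assumes R_carrier: "R \<subseteq> carrier (free_group A)"
begin

abbreviation F where "F \<equiv> free_group A"
abbreviation G where "G \<equiv> presented_group A R"
abbreviation rep where "rep \<equiv> represented A R"
abbreviation N where "N \<equiv> normal_closure F R"

sublocale F: group F by (rule group_free_group)

sublocale normal N F
  using R_carrier by (intro normal_normal_closure group_free_group)

lemma mult_inv_cancel [simp]:
  assumes "x \<in> carrier F" "y \<in> carrier F"
  shows "x \<otimes>\<^bsub>F\<^esub> (inv\<^bsub>F\<^esub> x \<otimes>\<^bsub>F\<^esub> y) = y" "inv\<^bsub>F\<^esub> x \<otimes>\<^bsub>F\<^esub> (x \<otimes>\<^bsub>F\<^esub> y) = y"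
  using assms by (simp_all flip: F.m_assoc)

lemma red_app: "reduce (u @ v) = reduce u \<otimes>\<^bsub>F\<^esub> reduce v"
  by (simp add: free_group_def)

lemma red_inv:
  assumes "w \<in> words A" shows "reduce (inv_word w) = inv\<^bsub>F\<^esub> reduce w"
proof -
  have "reduce (inv_word w) \<otimes>\<^bsub>F\<^esub> reduce w = \<one>\<^bsub>F\<^esub>"
    using reduce_inv_word_append[of w] by (simp only: red_app one_free_group)
  then show ?thesis using assms by (metis F.inv_equality reduce_in_carrier words_simps(4))
qed

text \<open>This is the relation under the \<open>LEAST\<close> of \<open>area\<close>, stated for
  group elements and for a given number of conjugates. Fillings can thus be multiplied, conjugated
  and inverted before minimality enters.\<close>

definition filling :: "nat \<Rightarrow> 'a word \<Rightarrow> bool" where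
  "filling m g \<longleftrightarrow> (\<exists>cs. length cs = m \<and> set cs \<subseteq> carrier F \<times> R \<times> {1, -1} \<and> g = conj_product A cs)"

lemma area_eq_Least: "area A R w = (LEAST m. filling m (reduce w))"
  by (simp add: area_def filling_def)

lemma conj_product_simps [simp]:
  "conj_product A [] = \<one>\<^bsub>F\<^esub>"
  "conj_product A ((f, r, e) # cs) =
     inv\<^bsub>F\<^esub> f \<otimes>\<^bsub>F\<^esub> (r [^]\<^bsub>F\<^esub> e) \<otimes>\<^bsub>F\<^esub> f \<otimes>\<^bsub>F\<^esub> conj_product A cs"
  by (simp_all add: conj_product_def)

lemma conj_product_closed:
  "set cs \<subseteq> carrier F \<times> R \<times> {1, -1 :: int} \<Longrightarrow> conj_product A cs \<in> carrier F"
proof (induction cs)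
  case (Cons c cs)
  obtain f r e where [simp]: "c = (f, r, e)" by (cases c)
  show ?case using Cons R_carrier by auto
qed simp

lemma conj_product_append:
  "set cs \<subseteq> carrier F \<times> R \<times> {1, -1 :: int} \<Longrightarrow> set ds \<subseteq> carrier F \<times> R \<times> {1, -1 :: int} \<Longrightarrow>
   conj_product A (cs @ ds) = conj_product A cs \<otimes>\<^bsub>F\<^esub> conj_product A ds"
proof (induction cs)
  case Nil
  then show ?case by (simp add: conj_product_closed)
next
  case (Cons c cs)
  obtain f r e where [simp]: "c = (f, r, e)" by (cases c)
  have "r \<in> carrier F" "f \<in> carrier F" using Cons.prems R_carrier by auto
  then show ?case using Cons by (simp add: F.m_assoc conj_product_closed)
qed

lemma filling_one: "filling 0 \<one>\<^bsub>F\<^esub>"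
  by (auto simp: filling_def)

lemma filling_closed: "filling m g \<Longrightarrow> g \<in> carrier F"
  by (auto simp: filling_def conj_product_closed)

lemma filling_mult:
  assumes "filling m g" "filling k h" shows "filling (m + k) (g \<otimes>\<^bsub>F\<^esub> h)"
proof -
  from assms obtain cs ds where "length cs = m" "set cs \<subseteq> carrier F \<times> R \<times> {1, -1}"
    "g = conj_product A cs" "length ds = k" "set ds \<subseteq> carrier F \<times> R \<times> {1, -1}"
    "h = conj_product A ds" by (auto simp: filling_def)
  then show ?thesis unfolding filling_def
    by (intro exI[of _ "cs @ ds"]) (simp add: conj_product_append)
qed

lemma filling_relator:
  assumes "f \<in> carrier F" "r \<in> R" "e \<in> {1, -1}"
  shows "filling 1 (inv\<^bsub>F\<^esub> f \<otimes>\<^bsub>F\<^esub> (r [^]\<^bsub>F\<^esub> (e :: int)) \<otimes>\<^bsub>F\<^esub> f)"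
proof -
  have "r \<in> carrier F" using assms R_carrier by auto
  then show ?thesis unfolding filling_def using assms
    by (intro exI[of _ "[(f, r, e)]"]) auto
qed

text \<open>Inserting \<open>h\<close> and its inverse between consecutive factors turns each
  conjugator \<open>f\<close> into \<open>f\<close> times \<open>h\<close> and leaves the number of
  factors unchanged.\<close>

lemma filling_conj:
  assumes "filling m g" "h \<in> carrier F"
  shows "filling m (inv\<^bsub>F\<^esub> h \<otimes>\<^bsub>F\<^esub> g \<otimes>\<^bsub>F\<^esub> h)"
proof -
  have "length cs = m \<Longrightarrow> set cs \<subseteq> carrier F \<times> R \<times> {1, -1} \<Longrightarrow>
      filling m (inv\<^bsub>F\<^esub> h \<otimes>\<^bsub>F\<^esub> conj_product A cs \<otimes>\<^bsub>F\<^esub> h)" for cs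
  proof (induction cs arbitrary: m)
    case Nil
    then show ?case using assms filling_one by simp
  next
    case (Cons c cs)
    obtain f r e where [simp]: "c = (f, r, e)" by (cases c)
    let ?p = "conj_product A cs"
    have car: "r \<in> carrier F" "f \<in> carrier F" "?p \<in> carrier F" "h \<in> carrier F"
      using Cons.prems R_carrier assms conj_product_closed by auto
    have "filling (1 + length cs) (inv\<^bsub>F\<^esub> (f \<otimes>\<^bsub>F\<^esub> h) \<otimes>\<^bsub>F\<^esub> (r [^]\<^bsub>F\<^esub> e) \<otimes>\<^bsub>F\<^esub> (f \<otimes>\<^bsub>F\<^esub> h)
            \<otimes>\<^bsub>F\<^esub> (inv\<^bsub>F\<^esub> h \<otimes>\<^bsub>F\<^esub> ?p \<otimes>\<^bsub>F\<^esub> h))"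
      using Cons car by (intro filling_mult filling_relator) auto
    also have "inv\<^bsub>F\<^esub> (f \<otimes>\<^bsub>F\<^esub> h) \<otimes>\<^bsub>F\<^esub> (r [^]\<^bsub>F\<^esub> e) \<otimes>\<^bsub>F\<^esub> (f \<otimes>\<^bsub>F\<^esub> h)
            \<otimes>\<^bsub>F\<^esub> (inv\<^bsub>F\<^esub> h \<otimes>\<^bsub>F\<^esub> ?p \<otimes>\<^bsub>F\<^esub> h) =
          inv\<^bsub>F\<^esub> h \<otimes>\<^bsub>F\<^esub> conj_product A (c # cs) \<otimes>\<^bsub>F\<^esub> h"
      using car by (simp add: F.inv_mult_group F.m_assoc)
    finally show ?case using Cons.prems by simp
  qed
  then show ?thesis using assms by (auto simp: filling_def)
qed

text \<open>Inversion reverses the order of the factors and negates each exponent, which stays in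
  \<open>{1, -1}\<close>.\<close>

lemma filling_inv:
  assumes "filling m g"
  shows "filling m (inv\<^bsub>F\<^esub> g)"
proof -
  have "length cs = m \<Longrightarrow> set cs \<subseteq> carrier F \<times> R \<times> {1, -1} \<Longrightarrow>
      filling m (inv\<^bsub>F\<^esub> conj_product A cs)" for cs
  proof (induction cs arbitrary: m)
    case Nil
    then show ?case using filling_one by simp
  next
    case (Cons c cs)
    obtain f r e where [simp]: "c = (f, r, e)" by (cases c)
    let ?p = "conj_product A cs"
    have car: "r \<in> carrier F" "f \<in> carrier F" "?p \<in> carrier F"
      using Cons.prems R_carrier conj_product_closed by auto
    have "filling (length cs + 1) (inv\<^bsub>F\<^esub> ?p \<otimes>\<^bsub>F\<^esub>
            (inv\<^bsub>F\<^esub> f \<otimes>\<^bsub>F\<^esub> (r [^]\<^bsub>F\<^esub> (- e)) \<otimes>\<^bsub>F\<^esub> f))"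
      using Cons car by (intro filling_mult filling_relator) auto
    also have "inv\<^bsub>F\<^esub> ?p \<otimes>\<^bsub>F\<^esub> (inv\<^bsub>F\<^esub> f \<otimes>\<^bsub>F\<^esub> (r [^]\<^bsub>F\<^esub> (- e)) \<otimes>\<^bsub>F\<^esub> f) =
          inv\<^bsub>F\<^esub> conj_product A (c # cs)"
      using car by (simp add: F.inv_mult_group F.m_assoc F.int_pow_neg)
    finally show ?case using Cons.prems by simp
  qed
  then show ?thesis using assms by (auto simp: filling_def)
qed

text \<open>The elements that have a filling form a normal subgroup containing \<open>R\<close>, so
  they include the normal closure. Consequently the \<open>LEAST\<close> in \<open>area\<close> is
  attained for null-homotopic words.\<close>

lemma filling_exists:
  assumes "g \<in> N" shows "\<exists>m. filling m g"
proof -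
  let ?M = "{g. \<exists>m. filling m g}"
  have "?M \<lhd> F"
  proof (rule F.normal_invI)
    show "subgroup ?M F"
      by (rule F.subgroupI) (use filling_closed filling_one filling_mult filling_inv in blast)+
    show "h \<otimes>\<^bsub>F\<^esub> g \<otimes>\<^bsub>F\<^esub> inv\<^bsub>F\<^esub> h \<in> ?M" if "h \<in> carrier F" "g \<in> ?M" for h g
      using that filling_conj[of _ g "inv\<^bsub>F\<^esub> h"] by auto
  qed
  moreover have "R \<subseteq> ?M"
  proof
    fix r assume "r \<in> R"
    then have "r \<in> carrier F" using R_carrier by auto
    then show "r \<in> ?M" using filling_relator[OF F.one_closed \<open>r \<in> R\<close>, of 1] by auto
  qed
  ultimately have "N \<subseteq> ?M" unfolding normal_closure_def by blast
  with assms show ?thesis by auto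
qed

section \<open>Endpoints of paths as cosets of the normal closure\<close>

lemma carrier_presented_group: "carrier G = rcosets\<^bsub>F\<^esub> N"
  and mult_presented_group: "x \<otimes>\<^bsub>G\<^esub> y = x <#>\<^bsub>F\<^esub> y"
  and one_presented_group: "\<one>\<^bsub>G\<^esub> = N"
  by (simp_all add: presented_group_def FactGroup_def)

lemma rep_eq_coset:
  assumes "w \<in> words A" shows "rep w = N #>\<^bsub>F\<^esub> reduce w"
proof -
  \<comment> \<open>The induction needs an arbitrary starting vertex, written as the coset of a
    prefix \<open>u\<close> that has already been read.\<close>
  have "cayley_end A R (N #>\<^bsub>F\<^esub> reduce u) w = N #>\<^bsub>F\<^esub> reduce (u @ w)"
    if "u \<in> words A" "w \<in> words A" for u w
    using that
  proof (induction w arbitrary: u)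
    case (Cons x w)
    have x: "reduce [x] = [x]" by (simp add: reduce_def)
    have "[x] \<in> words A" using Cons by simp
    then have "[x] \<in> carrier F" using reduce_in_carrier[of "[x]" A] x by simp
    then have "(N #>\<^bsub>F\<^esub> reduce u) <#>\<^bsub>F\<^esub> presented_gen A R x = N #>\<^bsub>F\<^esub> reduce (u @ [x])"
      unfolding presented_gen_def red_app x using Cons by (simp add: rcos_sum)
    then have "cayley_end A R (N #>\<^bsub>F\<^esub> reduce u) (x # w) = cayley_end A R (N #>\<^bsub>F\<^esub> reduce (u @ [x])) w"
      by (simp add: cayley_end_def mult_presented_group)
    also have "\<dots> = N #>\<^bsub>F\<^esub> reduce ((u @ [x]) @ w)"
      using Cons by (intro Cons.IH) auto
    finally show ?case by simp
  qed (simp add: cayley_end_def)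
  from this[of "[]" w] assms have "cayley_end A R (N #>\<^bsub>F\<^esub> \<one>\<^bsub>F\<^esub>) w = N #>\<^bsub>F\<^esub> reduce w"
    by (simp add: one_free_group)
  then show ?thesis
    by (simp add: represented_def one_presented_group F.coset_mult_one[OF subset])
qed

lemma rep_closed [simp]: "w \<in> words A \<Longrightarrow> rep w \<in> carrier G"
  by (simp add: rep_eq_coset carrier_presented_group F.rcosetsI subset)

lemma rep_append: "u \<in> words A \<Longrightarrow> v \<in> words A \<Longrightarrow> rep (u @ v) = rep u \<otimes>\<^bsub>G\<^esub> rep v"
  by (simp add: rep_eq_coset mult_presented_group rcos_sum red_app)

lemma rep_Nil [simp]: "rep [] = \<one>\<^bsub>G\<^esub>"
  by (simp add: represented_def cayley_end_def)

sublocale G: group G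
  using R_carrier by (rule group_presented_group)

lemma rep_inv_word:
  assumes "w \<in> words A" shows "rep (inv_word w) = inv\<^bsub>G\<^esub> rep w"
proof -
  have "rep (inv_word w @ w) = rep []"
    using assms by (simp add: reduce_inv_word_append rep_eq_coset del: rep_Nil)
  then have "rep (inv_word w) \<otimes>\<^bsub>G\<^esub> rep w = \<one>\<^bsub>G\<^esub>"
    using assms by (simp add: rep_append)
  then show ?thesis using assms by (intro G.inv_equality[symmetric]) auto
qed

lemma rep_eq_one_iff:
  assumes "w \<in> words A"
  shows "rep w = \<one>\<^bsub>G\<^esub> \<longleftrightarrow> reduce w \<in> N"
proof -
  have "rep w = \<one>\<^bsub>G\<^esub> \<longleftrightarrow> N #>\<^bsub>F\<^esub> reduce w = N"
    by (simp add: rep_eq_coset assms one_presented_group)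
  then show ?thesis
    using assms F.coset_join1 rcos_const is_subgroup
    by (metis reduce_in_carrier F.is_group)
qed

lemma filling_area:
  assumes "w \<in> words A" "rep w = \<one>\<^bsub>G\<^esub>"
  shows "filling (area A R w) (reduce w)"
  unfolding area_eq_Least
  by (rule LeastI_ex) (use assms filling_exists rep_eq_one_iff in blast)

lemma area_le: "filling m (reduce w) \<Longrightarrow> area A R w \<le> m"
  unfolding area_eq_Least by (rule Least_le)

section \<open>Comparing words with the same endpoint\<close>

lemma rep_append_inv_word_eq_one_iff:
  assumes "u \<in> words A" "v \<in> words A"
  shows "rep (u @ inv_word v) = \<one>\<^bsub>G\<^esub> \<longleftrightarrow> rep u = rep v"
  using assms by (metis G.inv_inv G.inv_equality G.r_inv rep_append rep_closed rep_inv_word words_simps(4))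

text \<open>\<open>gap\<close> is a pseudometric on words representing the same element, invariant under left and right
  concatenation.\<close>

definition gap :: "'a word \<Rightarrow> 'a word \<Rightarrow> nat" where
  "gap u v = area A R (u @ inv_word v)"

lemma open_area_eq_gap: "open_area A R T w = gap w (T (rep w))"
  by (simp add: open_area_def gap_def)

lemma filling_gap:
  assumes "u \<in> words A" "v \<in> words A" "rep u = rep v"
  shows "filling (gap u v) (reduce u \<otimes>\<^bsub>F\<^esub> inv\<^bsub>F\<^esub> reduce v)"
  using filling_area[of "u @ inv_word v"] assms rep_append_inv_word_eq_one_iff[of u v]
  by (simp add: gap_def red_app red_inv)

lemma gap_le:
  assumes "u \<in> words A" "v \<in> words A" "filling m (reduce u \<otimes>\<^bsub>F\<^esub> inv\<^bsub>F\<^esub> reduce v)"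
  shows "gap u v \<le> m"
  unfolding gap_def using assms by (intro area_le) (simp add: red_app red_inv)

lemma gap_refl: "u \<in> words A \<Longrightarrow> gap u u = 0"
  using gap_le[of u u 0] filling_one by simp

lemma gap_triangle:
  assumes "u \<in> words A" "v \<in> words A" "w \<in> words A" "rep u = rep v" "rep v = rep w"
  shows "gap u w \<le> gap u v + gap v w"
proof (rule gap_le)
  have "filling (gap u v + gap v w)
     (reduce u \<otimes>\<^bsub>F\<^esub> inv\<^bsub>F\<^esub> reduce v \<otimes>\<^bsub>F\<^esub> (reduce v \<otimes>\<^bsub>F\<^esub> inv\<^bsub>F\<^esub> reduce w))"
    using assms by (intro filling_mult filling_gap) auto
  then show "filling (gap u v + gap v w) (reduce u \<otimes>\<^bsub>F\<^esub> inv\<^bsub>F\<^esub> reduce w)"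
    using assms by (simp add: F.m_assoc)
qed (use assms in auto)

text \<open>In the quotient of the two extended words the common suffix \<open>q\<close> cancels and
  the common prefix \<open>p\<close> becomes a conjugation, which preserves fillings.\<close>

lemma gap_context:
  assumes "u \<in> words A" "v \<in> words A" "p \<in> words A" "q \<in> words A" "rep u = rep v"
  shows "gap (p @ u @ q) (p @ v @ q) \<le> gap u v"
proof (rule gap_le)
  have "filling (gap u v) (inv\<^bsub>F\<^esub> (inv\<^bsub>F\<^esub> reduce p) \<otimes>\<^bsub>F\<^esub> (reduce u \<otimes>\<^bsub>F\<^esub> inv\<^bsub>F\<^esub> reduce v) \<otimes>\<^bsub>F\<^esub> inv\<^bsub>F\<^esub> reduce p)"
    using assms by (intro filling_conj filling_gap) auto
  then show "filling (gap u v) (reduce (p @ u @ q) \<otimes>\<^bsub>F\<^esub> inv\<^bsub>F\<^esub> reduce (p @ v @ q))"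
    using assms by (simp add: F.m_assoc red_app F.inv_mult_group)
qed (use assms in auto)

lemma gap_Nil: "gap w [] = area A R w"
  by (simp add: gap_def inv_word_def)

lemma area_append_le:
  assumes "u \<in> words A" "v \<in> words A" "rep u = \<one>\<^bsub>G\<^esub>" "rep v = \<one>\<^bsub>G\<^esub>"
  shows "area A R (u @ v) \<le> area A R u + area A R v"
  using assms by (intro area_le) (simp add: red_app filling_mult filling_area)

end

section \<open>Dickson's lemma\<close>

text \<open>Every sequence has a monotone subsequence. If that one is decreasing, it is constant
  from the index of its minimum on, and this tail serves instead.\<close>

lemma nat_incseq_subseq:
  fixes f :: "nat \<Rightarrow> nat"
  shows "\<exists>s. strict_mono s \<and> incseq (\<lambda>i. f (s i))"
proof -
  obtain s where s: "strict_mono s" "monoseq (\<lambda>i. f (s i))"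
    using seq_monosub[of f] by auto
  show ?thesis
  proof (cases "incseq (\<lambda>i. f (s i))")
    case False
    then have dec: "decseq (\<lambda>i. f (s i))" using s(2) by (auto simp: monoseq_iff)
    obtain k where k: "\<And>i. f (s k) \<le> f (s i)"
      using ex_has_least_nat[of "\<lambda>_. True" _ "\<lambda>i. f (s i)"] by auto
    have "f (s (k + i)) = f (s k)" for i
      using k[of "k + i"] decseqD[OF dec, of k "k + i"] by simp
    then show ?thesis using s(1)
      by (intro exI[of _ "\<lambda>i. s (k + i)"]) (auto simp: strict_mono_def incseq_def)
  qed (use s in blast)
qed

text \<open>Subsequences are extracted for one coordinate at a time. Each further extraction keeps
  the coordinates already treated increasing.\<close>

lemma dickson:
  fixes f :: "nat \<Rightarrow> 'b \<Rightarrow> nat"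
  assumes "finite B"
  shows "\<exists>s. strict_mono s \<and> (\<forall>b\<in>B. incseq (\<lambda>i. f (s i) b))"
  using assms
proof (induction B)
  case empty
  show ?case by (intro exI[of _ id]) (auto simp: strict_mono_def)
next
  case (insert b B)
  then obtain s where s: "strict_mono s" "\<forall>b\<in>B. incseq (\<lambda>i. f (s i) b)" by blast
  obtain t where t: "strict_mono t" "incseq (\<lambda>i. f (s (t i)) b)"
    using nat_incseq_subseq[of "\<lambda>i. f (s i) b"] by blast
  have "incseq (\<lambda>i. f (s (t i)) b)" if "b \<in> B" for b
    using s that t(1) by (auto simp: incseq_def strict_mono_less_eq)
  then show ?case using s t strict_mono_compose[OF t(1) s(1)]
    by (intro exI[of _ "\<lambda>i. s (t i)"]) (auto simp: strict_mono_def)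
qed

section \<open>Exponent sums\<close>

definition letter_exponent :: "'a \<Rightarrow> 'a letter \<Rightarrow> real" where
  "letter_exponent a x = (if fst x = a then if snd x then 1 else -1 else 0)"

definition exponent :: "'a \<Rightarrow> 'a word \<Rightarrow> real" where
  "exponent a w = sum_list (map (letter_exponent a) w)"

lemma exponent_simps [simp]:
  "exponent a [] = 0" "exponent a (x # w) = letter_exponent a x + exponent a w"
  by (simp_all add: exponent_def)

lemma exponent_eq_count:
  "exponent a w = real (count (mset w) (a, True)) - real (count (mset w) (a, False))"
  by (induction w) (auto simp: letter_exponent_def)

section \<open>Quadratic area in abelian groups\<close>

locale abelian_presentation = presentation A R for A :: "'a set" and R +
  assumes finite_A: "finite A"
    and commutative: "comm_group (presented_group A R)"
begin

sublocale G: comm_group G by (rule commutative)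

lemma finite_letters: "finite (letters A)"
  using finite_A by (simp add: letters_def)

lemma finite_words_length_le: "finite {w \<in> words A. length w \<le> n}"
  using finite_lists_length_le[OF finite_letters, of n]
  by (rule rev_finite_subset) (auto simp: words_def)

lemma words_mset_cong: "mset u = mset v \<Longrightarrow> u \<in> words A \<longleftrightarrow> v \<in> words A"
  by (metis in_lists_conv_set set_mset_mset words_def)

lemma rep_swap:
  assumes "u \<in> words A" "v \<in> words A" "p \<in> words A" "q \<in> words A"
  shows "rep (p @ u @ v @ q) = rep (p @ v @ u @ q)"
  using assms by (simp add: rep_append G.m_ac)

text \<open>The first letter of \<open>u\<close> is located in \<open>v\<close> and commuted to the
  front; the rest is induction. From here on, null-homotopy can be treated as a property of
  multisets of letters.\<close>

lemma rep_mset_cong: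
  assumes "u \<in> words A" "mset u = mset v"
  shows "rep u = rep v"
  using assms
proof (induction u arbitrary: v)
  case (Cons x u)
  then obtain p q where v: "v = p @ x # q"
    by (metis list.set_intros(1) mset_eq_setD split_list)
  have w: "p \<in> words A" "q \<in> words A" "[x] \<in> words A" "u \<in> words A"
    using Cons.prems words_mset_cong[OF Cons.prems(2)] v by auto
  have "rep u = rep (p @ q)" using Cons v w by auto
  then have "rep ([x] @ u) = rep ([x] @ p @ q)" using w by (simp only: rep_append words_simps)
  also have "\<dots> = rep (p @ [x] @ q)" using rep_swap[of "[x]" p "[]" q] w by simp
  finally show ?case using v by simp
qed simp

text \<open>A sum in place of a maximum: it bounds the cost of every single transposition and makes
  sense for empty \<open>A\<close> too.\<close>

definition swap_cost :: nat where
  "swap_cost = (\<Sum>x\<in>letters A. \<Sum>y\<in>letters A. gap [x, y] [y, x])"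

lemma gap_swap_le:
  assumes "x \<in> letters A" "y \<in> letters A"
  shows "gap [x, y] [y, x] \<le> swap_cost"
proof -
  have "gap [x, y] [y, x] \<le> (\<Sum>y\<in>letters A. gap [x, y] [y, x])"
    using finite_letters assms by (intro member_le_sum) auto
  also have "\<dots> \<le> swap_cost"
    unfolding swap_cost_def
    using finite_letters assms by (intro member_le_sum[of x _ "\<lambda>x. \<Sum>y\<in>letters A. gap [x, y] [y, x]"]) auto
  finally show ?thesis .
qed

lemma gap_move_le:
  assumes "p \<in> words A" "x \<in> letters A"
  shows "gap (x # p) (p @ [x]) \<le> swap_cost * length p"
  using assms
proof (induction p)
  case Nil
  then show ?case by (simp add: gap_refl)
next
  case (Cons y p)
  then have yp: "y \<in> letters A" "p \<in> words A" by auto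
  have "gap (x # y # p) (y # p @ [x]) \<le> gap (x # y # p) (y # x # p) + gap (y # x # p) (y # p @ [x])"
    using Cons.prems yp by (intro gap_triangle rep_mset_cong) auto
  also have "gap (x # y # p) (y # x # p) \<le> gap [x, y] [y, x]"
    using gap_context[of "[x, y]" "[y, x]" "[]" p] rep_mset_cong[of "[x, y]" "[y, x]"] Cons.prems yp by auto
  also have "\<dots> \<le> swap_cost" using Cons.prems yp by (intro gap_swap_le)
  also have "gap (y # x # p) (y # p @ [x]) \<le> gap (x # p) (p @ [x])"
    using gap_context[of "x # p" "p @ [x]" "[y]" "[]"] rep_mset_cong[of "x # p" "p @ [x]"] Cons.prems yp by auto
  also have "\<dots> \<le> swap_cost * length p" using Cons yp by auto
  finally show ?case by simp
qed

text \<open>Insertion sort: each letter of \<open>u\<close> crosses at most \<open>length u\<close>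
  others on the way to its place in \<open>v\<close>, and each crossing costs at most
  \<open>swap_cost\<close>.\<close>

lemma gap_permute_le:
  assumes "u \<in> words A" "mset u = mset v"
  shows "gap u v \<le> swap_cost * length u ^ 2"
  using assms
proof (induction u arbitrary: v)
  case Nil
  then show ?case by (simp add: gap_refl)
next
  case (Cons x u)
  then obtain p q where v: "v = p @ x # q"
    by (metis list.set_intros(1) mset_eq_setD split_list)
  have w: "p \<in> words A" "q \<in> words A" "x \<in> letters A" "u \<in> words A"
    using Cons.prems words_mset_cong[OF Cons.prems(2)] v by auto
  have m: "mset u = mset (p @ q)" using Cons.prems v by auto
  then have len: "length p \<le> length u" by (metis le_add1 length_append mset_eq_length)
  have r: "rep u = rep (p @ q)" using m w by (intro rep_mset_cong) auto
  have "gap (x # u) v \<le> gap (x # u) (x # p @ q) + gap (x # p @ q) v"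
    using Cons.prems w v by (intro gap_triangle rep_mset_cong) auto
  also have "gap (x # u) (x # p @ q) \<le> gap u (p @ q)"
    using gap_context[of u "p @ q" "[x]" "[]"] w r by auto
  also have "\<dots> \<le> swap_cost * length u ^ 2" using Cons.IH w m by auto
  also have "gap (x # p @ q) v \<le> gap (x # p) (p @ [x])"
    using gap_context[of "x # p" "p @ [x]" "[]" q] rep_mset_cong[of "x # p" "p @ [x]"] w v by auto
  also have "\<dots> \<le> swap_cost * length p" using w by (intro gap_move_le)
  also have "\<dots> \<le> swap_cost * length u" using len by simp
  finally show ?case by (simp add: power2_eq_square algebra_simps)
qed

text \<open>Minimal nonempty null-homotopic multisets form an antichain, hence by Dickson's lemma
  have bounded size. The proof takes for each \<open>L\<close> a counterexample \<open>g L\<close>,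
  all of whose nonempty null-homotopic submultisets have more than \<open>L\<close> letters, and
  finds one counterexample inside another.\<close>

lemma short_trivial_subword:
  "\<exists>L. \<forall>w. w \<in> words A \<and> w \<noteq> [] \<and> rep w = \<one>\<^bsub>G\<^esub> \<longrightarrow>
     (\<exists>v. v \<in> words A \<and> v \<noteq> [] \<and> rep v = \<one>\<^bsub>G\<^esub> \<and> length v \<le> L \<and> mset v \<subseteq># mset w)"
  (is "\<exists>L. \<forall>w. ?P w \<longrightarrow> _ L w")
proof (rule ccontr)
  assume "\<not> ?thesis"
  then have "\<forall>L. \<exists>w. ?P w \<and> (\<forall>v. ?P v \<and> mset v \<subseteq># mset w \<longrightarrow> L < length v)"
    by (meson not_le)
  then obtain g where g: "\<And>L. ?P (g L)" "\<And>L v. ?P v \<Longrightarrow> mset v \<subseteq># mset (g L) \<Longrightarrow> L < length v"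
    by metis
  obtain s where s: "strict_mono s" "\<And>x. x \<in> letters A \<Longrightarrow> incseq (\<lambda>i. count (mset (g (s i))) x)"
    using dickson[OF finite_letters, of "\<lambda>i x. count (mset (g i)) x"] by blast
  \<comment> \<open>With this index, \<open>g (s 0)\<close> is a submultiset of
    \<open>g (s ?j)\<close> of size \<open>?j\<close>, so the choice of \<open>g\<close> forces
    \<open>s ?j < ?j\<close>, against strict monotonicity of \<open>s\<close>.\<close>
  let ?j = "length (g (s 0))"
  have "mset (g (s 0)) \<subseteq># mset (g (s ?j))"
  proof (rule mset_subset_eqI)
    fix x
    show "count (mset (g (s 0))) x \<le> count (mset (g (s ?j))) x"
    proof (cases "x \<in> letters A")
      case True
      then show ?thesis using incseqD[OF s(2)[OF True], of 0 ?j] by simp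
    next
      case False
      then have "x \<notin> set (g (s 0))" using g(1)[of "s 0"] by (auto simp: words_def)
      then show ?thesis by (simp add: count_mset_0_iff[THEN iffD2])
    qed
  qed
  then have "s ?j < ?j" using g by blast
  with seq_suble[OF s(1), of ?j] show False by simp
qed

text \<open>Up to the order of letters, \<open>w\<close> is a concatenation of at most
  \<open>length w\<close> short null-homotopic words, which gives a linear area. The quadratic term
  is the price of reaching that order.\<close>

lemma quadratic_area_bound:
  "\<exists>C. \<forall>w \<in> words A. rep w = \<one>\<^bsub>G\<^esub> \<longrightarrow> area A R w \<le> C * length w ^ 2"
proof -
  obtain L where L: "\<And>w. w \<in> words A \<Longrightarrow> w \<noteq> [] \<Longrightarrow> rep w = \<one>\<^bsub>G\<^esub> \<Longrightarrow>
     \<exists>v. v \<in> words A \<and> v \<noteq> [] \<and> rep v = \<one>\<^bsub>G\<^esub> \<and> length v \<le> L \<and> mset v \<subseteq># mset w"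
    using short_trivial_subword by blast
  \<comment> \<open>The sum includes words that do not represent the identity. Their
    \<open>area\<close> is an unspecified natural number, which can only enlarge
    \<open>c\<close>.\<close>
  define c where "c = (\<Sum>w \<in> {w \<in> words A. length w \<le> L}. area A R w)"
  have c: "area A R w \<le> c" if "w \<in> words A" "length w \<le> L" for w
    unfolding c_def using that finite_words_length_le by (intro member_le_sum) auto
  have rearranged: "\<exists>v. mset v = mset w \<and> area A R v \<le> c * length w"
    if "w \<in> words A" "rep w = \<one>\<^bsub>G\<^esub>" for w
    using that
  proof (induction "length w" arbitrary: w rule: less_induct)
    case less
    show ?case
    proof (cases "w = []")
      case True
      then show ?thesis using gap_refl[of "[]"] by (simp add: gap_Nil)
    next
      case False
      then obtain v where v: "v \<in> words A" "v \<noteq> []" "rep v = \<one>\<^bsub>G\<^esub>" "length v \<le> L"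
        "mset v \<subseteq># mset w" using L less by blast
      obtain u where u: "mset u = mset w - mset v" using ex_mset by blast
      then have m: "mset w = mset (v @ u)" using v by simp
      then have uw: "u \<in> words A" using words_mset_cong[OF m] less.prems by simp
      have len: "length w = length v + length u" using m by (metis length_append size_mset)
      have "rep v \<otimes>\<^bsub>G\<^esub> rep u = \<one>\<^bsub>G\<^esub>"
        using rep_mset_cong[OF _ m] less.prems v(1) uw by (simp add: rep_append)
      then have ru: "rep u = \<one>\<^bsub>G\<^esub>" using v uw by simp
      obtain u' where u': "mset u' = mset u" "area A R u' \<le> c * length u"
        using less.hyps[of u] len v(2) uw ru by auto
      have u'w: "u' \<in> words A" "rep u' = \<one>\<^bsub>G\<^esub>"
        using words_mset_cong[OF u'(1)] rep_mset_cong[of u' u] u' uw ru by auto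
      have "area A R (v @ u') \<le> c + c * length u"
        using area_append_le[of v u'] v u'w c[of v] u'(2) by simp
      \<comment> \<open>Splitting off the nonempty \<open>v\<close> shortens the word by at least
        one letter, which pays for the extra \<open>c\<close>.\<close>
      also have "\<dots> \<le> c * length w" using len v(2) by (cases v) (auto simp: algebra_simps)
      finally show ?thesis using m u' by (intro exI[of _ "v @ u'"]) auto
    qed
  qed
  show ?thesis
  proof (intro exI ballI impI)
    fix w assume w: "w \<in> words A" "rep w = \<one>\<^bsub>G\<^esub>"
    then obtain v where v: "mset v = mset w" "area A R v \<le> c * length w" using rearranged by blast
    have vw: "v \<in> words A" "rep v = rep w" using words_mset_cong[OF v(1)] rep_mset_cong[of v w] v w by auto
    have "gap w [] \<le> gap w v + gap v []" using w vw by (intro gap_triangle) auto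
    also have "\<dots> \<le> swap_cost * length w ^ 2 + c * length w"
      using gap_permute_le[of w v] v w vw by (simp add: gap_Nil)
    also have "\<dots> \<le> (swap_cost + c) * length w ^ 2"
      by (cases w) (auto simp: algebra_simps power2_eq_square)
    finally show "area A R w \<le> (swap_cost + c) * length w ^ 2" using w by (simp add: gap_Nil)
  qed
qed

section \<open>Geodesic length and exponent sums\<close>

text \<open>A letter and its inverse, wherever they occur, can be brought together and deleted
  without changing the endpoint or the exponent sums. Once no such pair is left, every generator
  occurs with one sign only, so the length equals the bound.\<close>

lemma word_shorten:
  assumes "w \<in> words A"
  shows "\<exists>v \<in> words A. rep v = rep w \<and> real (length v) \<le> (\<Sum>a\<in>A. \<bar>exponent a w\<bar>)"
  using assms
proof (induction "length w" arbitrary: w rule: less_induct)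
  case less
  show ?case
  proof (cases "\<exists>x \<in> set w. inv_letter x \<in> set w")
    case True
    then obtain x where x: "x \<in> set w" "inv_letter x \<in> set w" by blast
    obtain u where u: "mset u = mset w - {#x, inv_letter x#}" using ex_mset by blast
    \<comment> \<open>The two letters are distinct, so one occurrence of each suffices.\<close>
    have "{#x, inv_letter x#} \<subseteq># mset w"
      using x inv_letter_simps(2)[of x, symmetric] by (simp add: insert_subset_eq_iff in_diff_count)
    then have m: "mset w = mset (x # inv_letter x # u)"
      using subset_mset.add_diff_inverse[of "{#x, inv_letter x#}" "mset w"] u by simp
    then have words: "u \<in> words A" "x \<in> letters A" using words_mset_cong[OF m] less.prems by auto
    have "reduce [x, inv_letter x] = reduce []" by (simp add: reduce_def)
    then have "rep [x, inv_letter x] = \<one>\<^bsub>G\<^esub>"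
      using words by (simp add: rep_eq_coset flip: rep_Nil)
    then have "rep ([x, inv_letter x] @ u) = rep u"
      using words by (subst rep_append) auto
    then have "rep w = rep u" using rep_mset_cong[OF _ m] less.prems by simp
    moreover have "exponent a u = exponent a w" for a
    proof -
      have "exponent a w = exponent a (x # inv_letter x # u)"
        unfolding exponent_eq_count m by simp
      then show ?thesis by (simp add: letter_exponent_def inv_letter_def)
    qed
    moreover have "length u < length w" using m by (metis length_Cons lessI less_SucI size_mset)
    ultimately show ?thesis using less.hyps[of u] words by simp
  next
    case False
    have "\<bar>exponent a w\<bar> = (\<Sum>b\<in>UNIV. real (count (mset w) (a, b)))" for a
    proof -
      have "(a, True) \<notin> set w \<or> (a, False) \<notin> set w" using False by (force simp: inv_letter_def)
      then show ?thesis by (auto simp: exponent_eq_count UNIV_bool count_mset_0_iff[THEN iffD2])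
    qed
    then have "(\<Sum>a\<in>A. \<bar>exponent a w\<bar>) = (\<Sum>x\<in>letters A. real (count (mset w) x))"
      by (simp add: letters_def sum.cartesian_product)
    also have "\<dots> = real (\<Sum>x\<in>letters A. count (mset w) x)" by simp
    also have "(\<Sum>x\<in>letters A. count (mset w) x) = length w"
      using sum_count_set[of w "letters A"] less.prems finite_letters
      by (auto simp: words_def in_lists_conv_set subset_iff simp flip: count_mset)
    finally show ?thesis using less.prems by auto
  qed
qed

section \<open>Sums over all words of a given length\<close>

lemma card_letters: "card (letters A) = 2 * card A"
  by (simp add: letters_def card_cartesian_product)

lemma card_words_length: "card {w \<in> words A. length w = n} = (2 * card A) ^ n"
  using card_lists_length_eq[OF finite_letters, of n] card_letters
  by (simp add: words_def in_lists_conv_set Collect_conj_eq conj_commute subset_iff lists_eq_set Int_commute)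

lemma sum_words_Suc:
  "(\<Sum>w | w \<in> words A \<and> length w = Suc n. f w) = (\<Sum>w | w \<in> words A \<and> length w = n. \<Sum>x\<in>letters A. f (x # w))"
proof -
  have "(\<Sum>w | w \<in> words A \<and> length w = Suc n. f w) =
    (\<Sum>(w, x) \<in> {w \<in> words A. length w = n} \<times> letters A. f (x # w))"
    by (rule sum.reindex_bij_witness[of _ "\<lambda>(w, x). x # w" "\<lambda>w. (tl w, hd w)"])
       (auto simp: length_Suc_conv)
  then show ?thesis by (simp add: sum.cartesian_product)
qed

lemma sum_words_add:
  "(\<Sum>w | w \<in> words A \<and> length w = m + n. f w) =
   (\<Sum>u | u \<in> words A \<and> length u = m. \<Sum>v | v \<in> words A \<and> length v = n. f (u @ v))"
proof -
  have "(\<Sum>w | w \<in> words A \<and> length w = m + n. f w) =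
    (\<Sum>(u, v) \<in> {w \<in> words A. length w = m} \<times> {w \<in> words A. length w = n}. f (u @ v))"
    by (rule sum.reindex_bij_witness[of _ "\<lambda>(u, v). u @ v" "\<lambda>w. (take m w, drop m w)"])
       (auto simp: words_def dest: in_set_takeD in_set_dropD)
  then show ?thesis by (simp add: sum.cartesian_product)
qed

text \<open>This is the second moment of a lazy simple random walk, multiplied by the number of
  words. Expanding the square after one more letter, the cross term vanishes because a generator and
  its inverse have opposite exponents.\<close>

lemma sum_exponent_squares_le:
  assumes "a \<in> A"
  shows "(\<Sum>w | w \<in> words A \<and> length w = n. (exponent a w)\<^sup>2) \<le> real n * (2 * real (card A)) ^ n"
proof (induction n)
  case 0
  have "{w \<in> words A. w = []} = {[]}" by auto
  then show ?case by simp
next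
  case (Suc n)
  let ?q = "2 * real (card A)"
  have sums: "(\<Sum>x\<in>letters A. letter_exponent a x) = 0" "(\<Sum>x\<in>letters A. (letter_exponent a x)\<^sup>2) = 2"
  proof -
    \<comment> \<open>Only \<open>a\<close> and its inverse contribute when \<open>g 0 = 0\<close>;
      taking the identity and the square for \<open>g\<close> gives both moments.\<close>
    have "(\<Sum>x\<in>letters A. g (letter_exponent a x)) = g 1 + g (-1)" if "g 0 = 0" for g :: "real \<Rightarrow> real"
    proof -
      have "(\<Sum>x\<in>letters A. g (letter_exponent a x)) = (\<Sum>b\<in>A. if b = a then g 1 + g (-1) else 0)"
        unfolding letters_def sum.cartesian_product'
        by (rule sum.cong) (auto simp: letter_exponent_def UNIV_bool that)
      then show ?thesis using assms finite_A by simp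
    qed
    from this[of "\<lambda>x. x"] this[of "\<lambda>x. x\<^sup>2"]
    show "(\<Sum>x\<in>letters A. letter_exponent a x) = 0" "(\<Sum>x\<in>letters A. (letter_exponent a x)\<^sup>2) = 2"
      by simp_all
  qed
  have "(\<Sum>x\<in>letters A. (exponent a (x # w))\<^sup>2) = ?q * (exponent a w)\<^sup>2 + 2" for w
  proof -
    have "(\<Sum>x\<in>letters A. (exponent a (x # w))\<^sup>2) =
      (\<Sum>x\<in>letters A. (letter_exponent a x)\<^sup>2) + 2 * exponent a w * (\<Sum>x\<in>letters A. letter_exponent a x)
       + (\<Sum>x\<in>letters A. (exponent a w)\<^sup>2)"
      by (simp add: power2_sum sum.distrib sum_distrib_left algebra_simps)
    then show ?thesis by (simp add: sums card_letters)
  qed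
  then have "(\<Sum>w | w \<in> words A \<and> length w = Suc n. (exponent a w)\<^sup>2) =
     ?q * (\<Sum>w | w \<in> words A \<and> length w = n. (exponent a w)\<^sup>2) + 2 * ?q ^ n"
    by (simp add: sum_words_Suc sum.distrib card_words_length flip: sum_distrib_left)
  \<comment> \<open>The exact increment of the mean is 2 divided by \<open>?q\<close>, and this is
    at most 1 since \<open>A\<close> contains \<open>a\<close>.\<close>
  also have "\<dots> \<le> ?q * (real n * ?q ^ n) + ?q * ?q ^ n"
  proof (intro add_mono mult_left_mono mult_right_mono Suc.IH)
    show "2 \<le> ?q" using assms finite_A by (auto simp: Suc_le_eq card_gt_0_iff)
  qed auto
  also have "\<dots> = real (Suc n) * ?q ^ Suc n" by (simp add: algebra_simps)
  finally show ?case .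
qed

section \<open>Subadditivity of the mean up to a linear error\<close>

context
  fixes T
  assumes T: "geodesic_combing A R T"
begin

lemma combing_word [simp]: "w \<in> words A \<Longrightarrow> T (rep w) \<in> words A"
  and rep_combing [simp]: "w \<in> words A \<Longrightarrow> rep (T (rep w)) = rep w"
  and combing_geodesic: "w \<in> words A \<Longrightarrow> v \<in> words A \<Longrightarrow> rep v = rep w \<Longrightarrow> length (T (rep w)) \<le> length v"
  using T by (auto simp: geodesic_combing_def combing_def geodesic_def)

text \<open>The geodesic is no longer than the word from \<open>word_shorten\<close>. One factor
  \<open>card A\<close> comes from Cauchy-Schwarz over the generators, the other from adding their
  equal second-moment bounds.\<close>

lemma sum_length_combing_squares_le:
  "(\<Sum>w | w \<in> words A \<and> length w = n. (real (length (T (rep w))))\<^sup>2)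
     \<le> (real (card A))\<^sup>2 * real n * (2 * real (card A)) ^ n"
proof -
  have "(real (length (T (rep w))))\<^sup>2 \<le> real (card A) * (\<Sum>a\<in>A. (exponent a w)\<^sup>2)" if w: "w \<in> words A" for w
  proof -
    obtain v where v: "v \<in> words A" "rep v = rep w" "real (length v) \<le> (\<Sum>a\<in>A. \<bar>exponent a w\<bar>)"
      using word_shorten[OF w] by blast
    have "real (length (T (rep w))) \<le> (\<Sum>a\<in>A. \<bar>exponent a w\<bar>)"
      using combing_geodesic[OF w v(1,2)] v(3) by simp
    then have "(real (length (T (rep w))))\<^sup>2 \<le> (\<Sum>a\<in>A. \<bar>exponent a w\<bar>)\<^sup>2"
      by (intro power_mono) auto
    also have "\<dots> \<le> real (card A) * (\<Sum>a\<in>A. \<bar>exponent a w\<bar>\<^sup>2)"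
      using sum_squared_le_sum_of_squares[of "\<lambda>a. \<bar>exponent a w\<bar>" A]
      by (simp add: mult.commute)
    finally show ?thesis by simp
  qed
  then have "(\<Sum>w | w \<in> words A \<and> length w = n. (real (length (T (rep w))))\<^sup>2)
     \<le> (\<Sum>w | w \<in> words A \<and> length w = n. real (card A) * (\<Sum>a\<in>A. (exponent a w)\<^sup>2))"
    by (intro sum_mono) auto
  also have "\<dots> = real (card A) * (\<Sum>a\<in>A. \<Sum>w | w \<in> words A \<and> length w = n. (exponent a w)\<^sup>2)"
    by (subst sum.swap) (simp add: sum_distrib_left)
  also have "\<dots> \<le> real (card A) * (\<Sum>a\<in>A. real n * (2 * real (card A)) ^ n)"
    by (intro mult_left_mono sum_mono sum_exponent_squares_le) auto
  finally show ?thesis by (simp add: power2_eq_square algebra_simps)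
qed

text \<open>First \<open>u\<close>, then \<open>v\<close> is replaced by its combing path, at the
  cost of their open areas. What remains is a geodesic triangle, whose area is quadratic in its
  perimeter.\<close>

lemma open_area_append_le:
  "\<exists>C\<ge>0. \<forall>u \<in> words A. \<forall>v \<in> words A. real (open_area A R T (u @ v)) \<le>
      real (open_area A R T u) + real (open_area A R T v)
      + C * ((real (length (T (rep u))))\<^sup>2 + (real (length (T (rep v))))\<^sup>2)"
proof -
  obtain C where C: "\<And>w. w \<in> words A \<Longrightarrow> rep w = \<one>\<^bsub>G\<^esub> \<Longrightarrow> area A R w \<le> C * length w ^ 2"
    using quadratic_area_bound by blast
  show ?thesis
  \<comment> \<open>The factor 8 is 4 times 2: the perimeter is at most twice the sum of the two
    shorter-path lengths \<open>length (t u)\<close> and \<open>length (t v)\<close>, and squaring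
    that sum costs another factor 2.\<close>
  proof (intro exI[of _ "8 * real C"] conjI ballI)
    fix u v assume uv: "u \<in> words A" "v \<in> words A"
    define t where "t w = T (rep w)" for w
    have [simp]: "t w \<in> words A" "rep (t w) = rep w" if "w \<in> words A" for w
      using that by (auto simp: t_def)
    have "gap (u @ v) (t (u @ v)) \<le> gap (u @ v) (t u @ v) + gap (t u @ v) (t (u @ v))"
      using uv by (intro gap_triangle) (auto simp: rep_append)
    also have "gap (t u @ v) (t (u @ v)) \<le> gap (t u @ v) (t u @ t v) + gap (t u @ t v) (t (u @ v))"
      using uv by (intro gap_triangle) (auto simp: rep_append)
    also have "gap (u @ v) (t u @ v) \<le> gap u (t u)"
      using gap_context[of u "t u" "[]" v] uv by simp
    also have "gap (t u @ v) (t u @ t v) \<le> gap v (t v)"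
      using gap_context[of v "t v" "t u" "[]"] uv by simp
    also have "gap (t u @ t v) (t (u @ v)) \<le> C * length ((t u @ t v) @ inv_word (t (u @ v))) ^ 2"
      unfolding gap_def using uv
      by (intro C, simp, subst rep_append_inv_word_eq_one_iff) (auto simp: rep_append)
    also have "\<dots> \<le> C * (2 * (length (t u) + length (t v))) ^ 2"
    proof (intro mult_left_mono power_mono)
      \<comment> \<open>Geodesicity enters here: the third side is no longer than the path through
        the other two.\<close>
      have "length (t (u @ v)) \<le> length (t u @ t v)"
        unfolding t_def[of "u @ v"] using uv by (intro combing_geodesic) (auto simp: rep_append)
      then show "length ((t u @ t v) @ inv_word (t (u @ v))) \<le> 2 * (length (t u) + length (t v))"
        by (simp add: inv_word_def)
    qed auto
    finally have "gap (u @ v) (t (u @ v)) \<le> gap u (t u) + gap v (t v) + C * (2 * (length (t u) + length (t v)))\<^sup>2"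
      by simp
    then have "real (gap (u @ v) (t (u @ v))) \<le> real (gap u (t u) + gap v (t v) + C * (2 * (length (t u) + length (t v)))\<^sup>2)"
      by (simp only: of_nat_le_iff)
    also have "\<dots> = real (gap u (t u)) + real (gap v (t v)) + real C * (4 * (real (length (t u)) + real (length (t v)))\<^sup>2)"
      by (simp add: power2_eq_square algebra_simps)
    also have "\<dots> \<le> real (gap u (t u)) + real (gap v (t v)) + real C * (8 * ((real (length (t u)))\<^sup>2 + (real (length (t v)))\<^sup>2))"
    proof -
      have "(x + y)\<^sup>2 \<le> 2 * (x\<^sup>2 + y\<^sup>2)" for x y :: real
        using zero_le_power2[of "x - y"] by (simp add: power2_sum power2_diff)
      from this[of "real (length (t u))" "real (length (t v))"] show ?thesis
        by (intro add_left_mono mult_left_mono) auto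
    qed
    finally show "real (open_area A R T (u @ v)) \<le> real (open_area A R T u) + real (open_area A R T v)
      + 8 * real C * ((real (length (T (rep u))))\<^sup>2 + (real (length (T (rep v))))\<^sup>2)"
      by (simp add: open_area_eq_gap t_def algebra_simps)
  qed auto
qed

text \<open>Averaging the previous estimate over all pairs of words separates the variables, and the
  mean squared geodesic length is linear in the length of the word.\<close>

lemma D_osmean_add_le:
  "\<exists>c\<ge>0. \<forall>m n. D_osmean A R T (m + n) \<le> D_osmean A R T m + D_osmean A R T n + c * real (m + n)"
proof -
  let ?r = "real (card A)"
  let ?q = "2 * ?r"
  let ?W = "\<lambda>n. {w \<in> words A. length w = n}"
  define t where "t w = (real (length (T (rep w))))\<^sup>2" for w
  define oa where "oa w = real (open_area A R T w)" for w
  obtain C where C: "\<And>u v. u \<in> words A \<Longrightarrow> v \<in> words A \<Longrightarrow>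
     oa (u @ v) \<le> oa u + oa v + C * (t u + t v)" and "C \<ge> 0"
    unfolding oa_def t_def using open_area_append_le by blast
  have D: "D_osmean A R T n = (\<Sum>w\<in>?W n. oa w) / ?q ^ n" for n
    by (simp add: D_osmean_def oa_def)
  have tsum: "(\<Sum>w\<in>?W n. t w) / ?q ^ n \<le> ?r\<^sup>2 * real n" for n
  \<comment> \<open>If \<open>A\<close> is empty and \<open>n\<close> is positive, the denominator
    is 0 and the quotient is 0 by convention.\<close>
  proof (cases "?q ^ n = 0")
    case True
    then show ?thesis by (simp only: div_by_0) simp
  next
    case False
    then have "?q ^ n > 0" by (simp add: less_le del: power_eq_0_iff)
    then show ?thesis using sum_length_combing_squares_le[of n] by (simp add: pos_divide_le_eq t_def)
  qed
  have "D_osmean A R T (m + n) \<le> D_osmean A R T m + D_osmean A R T n + C * ?r\<^sup>2 * real (m + n)" for m n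
  \<comment> \<open>For empty \<open>A\<close> only the empty word exists, so the mean is
    \<open>oa []\<close> at 0 and vanishes elsewhere.\<close>
  proof (cases "card A = 0")
    case True
    have "D_osmean A R T k = (if k = 0 then oa [] else 0)" for k
    proof (cases k)
      case 0
      have "?W 0 = {[]}" by auto
      then show ?thesis using 0 unfolding D by simp
    qed (simp add: D True)
    moreover have "oa [] \<ge> 0" by (simp add: oa_def)
    ultimately show ?thesis using True by simp
  next
    case False
    then have q: "?q > 0" by simp
    have "(\<Sum>w\<in>?W (m + n). oa w) \<le> (\<Sum>u\<in>?W m. \<Sum>v\<in>?W n. oa u + oa v + C * (t u + t v))"
      unfolding sum_words_add by (intro sum_mono C) auto
    also have "\<dots> = ?q ^ n * (\<Sum>u\<in>?W m. oa u) + ?q ^ m * (\<Sum>v\<in>?W n. oa v)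
         + C * (?q ^ n * (\<Sum>u\<in>?W m. t u) + ?q ^ m * (\<Sum>v\<in>?W n. t v))"
      by (simp add: sum.distrib card_words_length distrib_left flip: sum_distrib_left)
    finally have "D_osmean A R T (m + n) \<le> (?q ^ n * (\<Sum>u\<in>?W m. oa u) + ?q ^ m * (\<Sum>v\<in>?W n. oa v)
         + C * (?q ^ n * (\<Sum>u\<in>?W m. t u) + ?q ^ m * (\<Sum>v\<in>?W n. t v))) / ?q ^ (m + n)"
      unfolding D using q by (intro divide_right_mono) auto
    also have "\<dots> = D_osmean A R T m + D_osmean A R T n
         + C * ((\<Sum>u\<in>?W m. t u) / ?q ^ m + (\<Sum>v\<in>?W n. t v) / ?q ^ n)"
    proof -
      have "(Q * a + P * b + C * (Q * x + P * y)) / (P * Q) = a / P + b / Q + C * (x / P + y / Q)"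
        if "P > 0" "Q > 0" for P Q a b x y :: real
        using that by (simp add: field_simps)
      from this[OF zero_less_power[OF q, of m] zero_less_power[OF q, of n]] show ?thesis
        unfolding D power_add by blast
    qed
    also have "\<dots> \<le> D_osmean A R T m + D_osmean A R T n + C * (?r\<^sup>2 * real m + ?r\<^sup>2 * real n)"
      using \<open>C \<ge> 0\<close> by (intro add_left_mono mult_left_mono add_mono tsum)
    finally show ?thesis by (simp add: algebra_simps)
  qed
  then show ?thesis using \<open>C \<ge> 0\<close> by (intro exI[of _ "C * ?r\<^sup>2"]) auto
qed

end

end

section \<open>Solving the recurrence and concluding\<close>

text \<open>Halving lowers the logarithm by at least \<open>ln (3/2)\<close> on both parts. With the
  coefficient \<open>c / ln (3/2)\<close> this gains exactly \<open>c * real n\<close>, the error of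
  one splitting.\<close>

lemma almost_subadditive_imp_n_ln_n:
  fixes D :: "nat \<Rightarrow> real"
  assumes "c \<ge> 0" and D: "\<And>m n. D (m + n) \<le> D m + D n + c * real (m + n)" and "n \<ge> 1"
  shows "D n \<le> D 1 * real n + c / ln (3/2) * (real n * ln (real n))"
  using \<open>n \<ge> 1\<close>
proof (induction n rule: less_induct)
  case (less n)
  let ?c = "c / ln (3/2)"
  have pos: "ln (3/2 :: real) > 0" by simp
  show ?case
  proof (cases "n = 1")
    case False
    \<comment> \<open>For \<open>n\<close> at least 2 the larger half is at most two thirds of
      \<open>n\<close>, with equality at \<open>n = 3\<close>. This is where 3/2 comes from.\<close>
    define m k where "m = n div 2" and "k = n - n div 2"
    have mk: "n = m + k" "1 \<le> m" "1 \<le> k" "m < n" "k < n" "3 * m \<le> 2 * n" "3 * k \<le> 2 * n"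
      using less.prems False by (auto simp: m_def k_def)
    have ln_bound: "real j * ln (real j) \<le> real j * (ln (real n) - ln (3/2))"
      if "1 \<le> j" "3 * j \<le> 2 * n" for j
    proof (rule mult_left_mono)
      have "ln (real j) \<le> ln (real n / (3/2))" using that by (subst ln_le_cancel_iff) auto
      also have "\<dots> = ln (real n) - ln (3/2)" using that by (subst ln_div) auto
      finally show "ln (real j) \<le> ln (real n) - ln (3/2)" .
    qed simp
    have "D n \<le> D m + D k + c * real n" using D[of m k] mk by simp
    also have "D m \<le> D 1 * real m + ?c * (real m * ln (real m))" using less.IH mk by blast
    also have "D k \<le> D 1 * real k + ?c * (real k * ln (real k))" using less.IH mk by blast
    also have "real m * ln (real m) \<le> real m * (ln (real n) - ln (3/2))" using ln_bound mk by blast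
    also have "real k * ln (real k) \<le> real k * (ln (real n) - ln (3/2))" using ln_bound mk by blast
    finally have "D n \<le> D 1 * real m + ?c * (real m * (ln (real n) - ln (3/2)))
        + (D 1 * real k + ?c * (real k * (ln (real n) - ln (3/2)))) + c * real n"
      using assms(1) pos by (simp add: mult_left_mono divide_right_mono)
    also have "\<dots> = D 1 * real n + ?c * (real n * (ln (real n) - ln (3/2))) + c * real n"
      unfolding mk(1) by (simp add: algebra_simps)
    also have "\<dots> = D 1 * real n + ?c * (real n * ln (real n))"
      using pos by (simp add: field_simps)
    finally show ?thesis .
  qed simp
qed

theorem theorem4p1:
  fixes A :: "'a set" and R :: "'a word set" and T :: "'a word set \<Rightarrow> 'a word"
  assumes "finite A"
    and "finite R" and "R \<subseteq> carrier (free_group A)"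
    and "comm_group (presented_group A R)"
    and "geodesic_combing A R T"
  shows "\<exists>K::real. \<forall>n::nat. n \<ge> 2 \<longrightarrow> D_osmean A R T n \<le> K * (real n * (ln (real n))\<^sup>2)"
proof -
  interpret abelian_presentation A R
    using assms by (intro abelian_presentation.intro presentation.intro abelian_presentation_axioms.intro)
  let ?D = "D_osmean A R T"
  obtain c where c: "c \<ge> 0" "\<And>m n. ?D (m + n) \<le> ?D m + ?D n + c * real (m + n)"
    using D_osmean_add_le[OF assms(5)] by blast
  define d where "d = c / ln (3/2)"
  have "d \<ge> 0" using c by (simp add: d_def)
  \<comment> \<open>Since \<open>ln (real n) / ln 2\<close> is at least 1, the linear term may be
    multiplied by its square and the \<open>n ln n\<close> term by its first power. The absolute
    value avoids a discussion of the sign of \<open>?D 1\<close>.\<close>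
  have "?D n \<le> (\<bar>?D 1\<bar> / (ln 2)\<^sup>2 + d / ln 2) * (real n * (ln (real n))\<^sup>2)" if "n \<ge> 2" for n
  proof -
    have l: "ln 2 \<le> ln (real n)" "0 < ln (2::real)" "0 \<le> ln (real n)" using that by auto
    have "1 \<le> (ln (real n) / ln 2)\<^sup>2" using l by (intro one_le_power) auto
    then have "\<bar>?D 1\<bar> * real n * 1 \<le> \<bar>?D 1\<bar> * real n * (ln (real n) / ln 2)\<^sup>2"
      by (intro mult_left_mono) auto
    moreover have "d * (real n * ln (real n)) * 1 \<le> d * (real n * ln (real n)) * (ln (real n) / ln 2)"
      using l \<open>d \<ge> 0\<close> by (intro mult_left_mono mult_nonneg_nonneg) auto
    moreover have "?D 1 * real n \<le> \<bar>?D 1\<bar> * real n" by (intro mult_right_mono) auto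
    moreover have "?D n \<le> ?D 1 * real n + d * (real n * ln (real n))"
      unfolding d_def using that by (intro almost_subadditive_imp_n_ln_n c) auto
    ultimately have "?D n \<le> \<bar>?D 1\<bar> * real n * (ln (real n) / ln 2)\<^sup>2 + d * (real n * ln (real n)) * (ln (real n) / ln 2)"
      by simp
    also have "\<dots> = (\<bar>?D 1\<bar> / (ln 2)\<^sup>2 + d / ln 2) * (real n * (ln (real n))\<^sup>2)"
      using l by (simp add: field_simps power2_eq_square)
    finally show ?thesis .
  qed
  then show ?thesis by blast
qed

end
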